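(* Let $G=([n],E)$ be a graph, let $w:E\to\mathbb N$, and let $|\psi\rangle\in\mathcal S_d(G,w)$. Choose an edge $e=\{x,y\}\in E$ and a vertex $z\in[n]\setminus\{x,y\}$. Let $$E'=(E\setminus\{e\})\cup\{\{x,z\},\{y,z\}\},$$ and extend $w$ by the convention $w(f)=1$ for $f\notin E$. Define $w':E'\to\mathbb N$ by $$w'(f)=\begin{cases} w(f)\,w(e), & f\in\{\{x,z\},\{y,z\}\},\\ w(f), & \text{otherwise.}\end{cases}$$ Then, for $G'=([n],E')$, we have $|\psi\rangle\in\mathcal S_d(G',w')$. Since $G'$ and $w'$ depend only on $G,w,e,z$, this gives $\mathcal S_d(G,w)\subseteq\mathcal S_d(G',w')$. In particular, if every original edge dimension satisfies $w(f)\le\chi$ ($f\in E$), then $w'(f)\le\chi^2$ for every $f\in E'$.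
   Context: Graphs are finite, simple and undirected; $[n]=\{1,\dots,n\}$; $\mathbb N$ denotes the positive integers. For a graph $G=([n],E)$, a weight function $w:E\to\mathbb N$ and $d\in\mathbb N$, the class $\mathcal S_d(G,w)$ is the set of pure (unit) states $|\psi\rangle=\sum_{i_1,\dots,i_n\in[d]}\psi_{i_1,\dots,i_n}|i_1,\dots,i_n\rangle\in(\mathbb C^d)^{\otimes n}$ for which there exist complex tensors $\varphi^{[v]}$, $v\in[n]$, where $\varphi^{[v]}$ has one physical index $i_v\in[d]$ and one virtual index $j_e\in[w(e)]$ for each edge $e$ incident to $v$, such that for all $i_1,\dots,i_n\in[d]$ $$\psi_{i_1,\dots,i_n}=\sum_{(j_e)_{e\in E}\in\prod_{e\in E}[w(e)]}\ \prod_{v\in[n]}\varphi^{[v]}_{i_v}\big((j_e)_{e\ni v}\big).$$ *)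

theory Defs
  imports Complex_Main "HOL-Library.FuncSet"
begin

text \<open>The graph \<open>([n], E)\<close> is given by \<open>n\<close> and by its set \<open>E\<close> of two-element subsets of
  \<open>{1..n}\<close>. Since the vertex set is finite, so is \<open>E\<close>.\<close>

definition simple_graph :: "nat \<Rightarrow> nat set set \<Rightarrow> bool" where
  "simple_graph n E \<longleftrightarrow> (\<forall>e\<in>E. \<exists>u\<in>{1..n}. \<exists>v\<in>{1..n}. u \<noteq> v \<and> e = {u, v})"

text \<open>A weight function \<open>E \<rightarrow> \<nat>\<close> with positive values is a total function of which only the
  values on \<open>E\<close> matter.\<close>

definition weighted_graph :: "nat \<Rightarrow> nat set set \<Rightarrow> (nat set \<Rightarrow> nat) \<Rightarrow> bool" where
  "weighted_graph n E w \<longleftrightarrow> simple_graph n E \<and> (\<forall>e\<in>E. 1 \<le> w e)"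

text \<open>A vector of \<open>(\<complex>\<^sup>d)\<^bsup>\<otimes>n\<^esup>\<close> is represented by its coefficients in the product
  basis, a function on the index tuples \<open>(i\<^sub>1, \<dots>, i\<^sub>n) \<in> [d]\<^sup>n\<close>. Tuples and coefficient
  functions are extensional, so that equal vectors are equal functions.\<close>

definition phys_indices :: "nat \<Rightarrow> nat \<Rightarrow> (nat \<Rightarrow> nat) set" where
  "phys_indices d n = {1..n} \<rightarrow>\<^sub>E {1..d}"

definition pure_states :: "nat \<Rightarrow> nat \<Rightarrow> ((nat \<Rightarrow> nat) \<Rightarrow> complex) set" where
  "pure_states d n = {\<psi> \<in> phys_indices d n \<rightarrow>\<^sub>E UNIV. (\<Sum>i\<in>phys_indices d n. (cmod (\<psi> i))\<^sup>2) = 1}"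

definition virt_indices :: "nat set set \<Rightarrow> (nat set \<Rightarrow> nat) \<Rightarrow> (nat set \<Rightarrow> nat) set" where
  "virt_indices E w = (\<Pi>\<^sub>E e\<in>E. {1..w e})"

definition incident_edges :: "nat set set \<Rightarrow> nat \<Rightarrow> nat set set" where
  "incident_edges E v = {e \<in> E. v \<in> e}"

text \<open>The entry of the local tensor at vertex \<open>v\<close> with physical index \<open>i v\<close> and virtual indices
  \<open>(j e)\<close> for \<open>e\<close> incident to \<open>v\<close> is \<open>\<phi> v (i v) (restrict j (incident_edges E v))\<close>. The
  restriction ensures that it does not depend on the indices of other edges.\<close>

definition contraction ::
  "nat \<Rightarrow> nat set set \<Rightarrow> (nat set \<Rightarrow> nat) \<Rightarrow> (nat \<Rightarrow> nat \<Rightarrow> (nat set \<Rightarrow> nat) \<Rightarrow> complex)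
     \<Rightarrow> (nat \<Rightarrow> nat) \<Rightarrow> complex" where
  "contraction n E w \<phi> i =
     (\<Sum>j\<in>virt_indices E w. \<Prod>v\<in>{1..n}. \<phi> v (i v) (restrict j (incident_edges E v)))"

definition tn_states ::
  "nat \<Rightarrow> nat \<Rightarrow> nat set set \<Rightarrow> (nat set \<Rightarrow> nat) \<Rightarrow> ((nat \<Rightarrow> nat) \<Rightarrow> complex) set" where
  "tn_states d n E w =
     {\<psi> \<in> pure_states d n. \<exists>\<phi>. \<forall>i\<in>phys_indices d n. \<psi> i = contraction n E w \<phi> i}"

definition rerouted_edges :: "nat set set \<Rightarrow> nat \<Rightarrow> nat \<Rightarrow> nat \<Rightarrow> nat set set" where
  "rerouted_edges E x y z = (E - {{x, y}}) \<union> {{x, z}, {y, z}}"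

definition extended_weight :: "nat set set \<Rightarrow> (nat set \<Rightarrow> nat) \<Rightarrow> nat set \<Rightarrow> nat" where
  "extended_weight E w f = (if f \<in> E then w f else 1)"

definition rerouted_weight ::
  "nat set set \<Rightarrow> (nat set \<Rightarrow> nat) \<Rightarrow> nat \<Rightarrow> nat \<Rightarrow> nat \<Rightarrow> nat set \<Rightarrow> nat" where
  "rerouted_weight E w x y z f =
     (if f \<in> {{x, z}, {y, z}} then extended_weight E w f * extended_weight E w {x, y}
      else extended_weight E w f)"

end

theory Submission
  imports Defs
begin

text \<open>Every index of \<open>{x, z}\<close> is read as a pair consisting of an old index of that edge and a copy of
  the index of \<open>{x, y}\<close>; likewise for \<open>{y, z}\<close>. The new tensor at \<open>z\<close> is the old one times a Kronecker
  delta of the two copies, so exactly the consistent index assignments contribute, and these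
  correspond bijectively to the old index assignments.\<close>

section \<open>Pairs of 1-based indices encoded as single indices\<close>

definition pack :: "nat \<Rightarrow> nat \<Rightarrow> nat \<Rightarrow> nat" where
  "pack m p q = (q - 1) * m + p"

text \<open>Subtracting 1 passes to 0-based indices, where \<open>p - 1\<close> is the low digit in
  base \<open>m\<close> and \<open>q - 1\<close> the high part. Decoding therefore needs
  \<open>m\<close> but not the range of \<open>q\<close>.\<close>

definition pack_fst :: "nat \<Rightarrow> nat \<Rightarrow> nat" where
  "pack_fst m k = (k - 1) mod m + 1"

definition pack_snd :: "nat \<Rightarrow> nat \<Rightarrow> nat" where
  "pack_snd m k = (k - 1) div m + 1"

lemma pack_fst_in:
  assumes "1 \<le> m"
  shows "pack_fst m k \<in> {1..m}"
  using assms mod_less_divisor[of m "k - 1"] by (auto simp: pack_fst_def simp del: mod_less_divisor)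

lemma pack_snd_in:
  assumes "k \<in> {1..m * D}"
  shows "pack_snd m k \<in> {1..D}"
proof -
  have "k - 1 < D * m"
    using assms by (auto simp: mult.commute)
  then show ?thesis
    by (auto simp: pack_snd_def Suc_le_eq less_mult_imp_div_less)
qed

lemma pack_in:
  assumes "p \<in> {1..m}" and "q \<in> {1..D}"
  shows "pack m p q \<in> {1..m * D}"
proof -
  obtain q' where q: "q = Suc q'"
    using assms(2) by (cases q) auto
  have "q' * m + p \<le> Suc q' * m"
    using assms(1) by auto
  also have "\<dots> \<le> D * m"
    using assms(2) q by (intro mult_right_mono) auto
  finally show ?thesis
    using assms(1) by (auto simp: pack_def q mult.commute)
qed

lemma pack_fst_pack:
  assumes "p \<in> {1..m}"
  shows "pack_fst m (pack m p q) = p"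
proof -
  \<comment> \<open>Since \<open>p\<close> is positive, the truncated subtraction is exact;
    \<open>p - 1 < m\<close> is then the remainder modulo \<open>m\<close>.\<close>
  have "pack m p q - 1 = (p - 1) + (q - 1) * m"
    using assms by (auto simp: pack_def)
  then have "(pack m p q - 1) mod m = ((p - 1) + (q - 1) * m) mod m"
    by (rule arg_cong)
  also have "\<dots> = p - 1"
    using assms by (subst mod_mult_self1) auto
  finally show ?thesis
    using assms by (simp add: pack_fst_def)
qed

lemma pack_snd_pack:
  assumes "p \<in> {1..m}" and "1 \<le> q"
  shows "pack_snd m (pack m p q) = q"
proof -
  have "pack m p q - 1 = (p - 1) + (q - 1) * m"
    using assms by (auto simp: pack_def)
  then have "(pack m p q - 1) div m = ((p - 1) + (q - 1) * m) div m"
    by (rule arg_cong)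
  also have "\<dots> = q - 1"
    using assms by (subst div_mult_self1) auto
  finally show ?thesis
    using assms by (simp add: pack_snd_def)
qed

text \<open>Division with remainder for \<open>k - 1\<close>. At \<open>k = 0\<close> truncated
  subtraction would give 1 instead of \<open>k\<close>.\<close>

lemma pack_collapse:
  assumes "1 \<le> k"
  shows "pack m (pack_fst m k) (pack_snd m k) = k"
  using assms by (simp add: pack_def pack_fst_def pack_snd_def)

lemma simple_graph_finite:
  assumes "simple_graph n E"
  shows "finite E"
proof (rule finite_subset)
  show "E \<subseteq> Pow {1..n}"
    using assms by (fastforce simp: simple_graph_def)
qed simp

section \<open>The rerouted weighted graph\<close>

locale rerouting =
  fixes n :: nat and E :: "nat set set" and w :: "nat set \<Rightarrow> nat" and x y z :: nat
  assumes graph: "weighted_graph n E w"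
    and xy: "{x, y} \<in> E"
    and z: "z \<in> {1..n} - {x, y}"
begin

abbreviation "E' \<equiv> rerouted_edges E x y z"
abbreviation "w' \<equiv> rerouted_weight E w x y z"
abbreviation "wxz \<equiv> extended_weight E w {x, z}"
abbreviation "wyz \<equiv> extended_weight E w {y, z}"

lemma x_ne_y: "x \<noteq> y"
  using graph xy by (force simp: weighted_graph_def simple_graph_def doubleton_eq_iff)

lemma x_y_in: "x \<in> {1..n}" "y \<in> {1..n}"
  using graph xy by (force simp: weighted_graph_def simple_graph_def doubleton_eq_iff)+

text \<open>Keeps the three special edges apart, so that the case distinctions on edges below do not
  overlap.\<close>

lemma edges_ne: "{x, z} \<noteq> {x, y}" "{y, z} \<noteq> {x, y}" "{x, z} \<noteq> {y, z}"
  using z x_ne_y by (auto simp: doubleton_eq_iff)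

lemma edge_in_rerouted: "f \<in> E' \<longleftrightarrow> f = {x, z} \<or> f = {y, z} \<or> f \<in> E \<and> f \<noteq> {x, y}"
  by (auto simp: rerouted_edges_def)

lemma extended_weight_ge_1: "1 \<le> extended_weight E w f"
  using graph by (auto simp: extended_weight_def weighted_graph_def)

lemma weighted_graph_rerouted: "weighted_graph n E' w'"
proof -
  have "simple_graph n E'"
    unfolding simple_graph_def
  proof
    fix f assume "f \<in> E'"
    then consider "f = {x, z}" | "f = {y, z}" | "f \<in> E"
      by (auto simp: edge_in_rerouted)
    then show "\<exists>u\<in>{1..n}. \<exists>v\<in>{1..n}. u \<noteq> v \<and> f = {u, v}"
    proof cases
      case 3
      then show ?thesis
        using graph by (simp add: weighted_graph_def simple_graph_def)
    qed (use x_y_in z in blast)+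
  qed
  moreover have "1 \<le> w' f" for f
    using extended_weight_ge_1[of f] extended_weight_ge_1[of "{x, y}"]
    by (auto simp: rerouted_weight_def Suc_le_eq)
  ultimately show ?thesis
    by (simp add: weighted_graph_def)
qed

lemma rerouted_weight_le_square:
  assumes "\<forall>f\<in>E. w f \<le> \<chi>"
  shows "w' f \<le> \<chi>\<^sup>2"
proof -
  \<comment> \<open>Edges outside \<open>E\<close> have extended weight 1, so the bound needs
    \<open>\<chi>\<close> to be positive; the edge \<open>{x, y}\<close> guarantees this.\<close>
  have "1 \<le> w {x, y}"
    using graph xy by (simp add: weighted_graph_def)
  then have "1 \<le> \<chi>"
    using assms xy by fastforce
  then have le: "extended_weight E w g \<le> \<chi>" for g
    using assms by (simp add: extended_weight_def)
  have "\<chi> \<le> \<chi>\<^sup>2"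
    by (simp add: power2_eq_square)
  then show ?thesis
    using le[of f] mult_mono[OF le[of f] le[of "{x, y}"]] order_trans[OF le[of f]]
    by (simp add: rerouted_weight_def power2_eq_square)
qed

section \<open>Translation of indices and tensors\<close>

text \<open>The vertex \<open>v\<close> decides which copy of the index of \<open>{x, y}\<close> is read, so that \<open>x\<close> and \<open>y\<close> only
  use indices of edges incident to them.\<close>

definition old_index :: "nat \<Rightarrow> (nat set \<Rightarrow> nat) \<Rightarrow> nat set \<Rightarrow> nat" where
  "old_index v r f =
     (if f = {x, y} then if v = x then pack_snd wxz (r {x, z}) else pack_snd wyz (r {y, z})
      else if f = {x, z} then pack_fst wxz (r f)
      else if f = {y, z} then pack_fst wyz (r f)
      else r f)"

text \<open>An edge \<open>{x, z}\<close> or \<open>{y, z}\<close> absent from \<open>E\<close> is treated as having the only index 1.\<close>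

definition new_index :: "(nat set \<Rightarrow> nat) \<Rightarrow> nat set \<Rightarrow> nat" where
  "new_index j f =
     (if f \<in> {{x, z}, {y, z}}
      then pack (extended_weight E w f) (if f \<in> E then j f else 1) (j {x, y}) else j f)"

definition consistent :: "(nat set \<Rightarrow> nat) \<Rightarrow> bool" where
  "consistent r \<longleftrightarrow> pack_snd wxz (r {x, z}) = pack_snd wyz (r {y, z})"

text \<open>Only \<open>z\<close> is incident to both \<open>{x, z}\<close> and
  \<open>{y, z}\<close>, so the Kronecker delta has to sit there.\<close>

definition rerouted_tensor ::
  "(nat \<Rightarrow> nat \<Rightarrow> (nat set \<Rightarrow> nat) \<Rightarrow> complex) \<Rightarrow> nat \<Rightarrow> nat \<Rightarrow> (nat set \<Rightarrow> nat) \<Rightarrow> complex" where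
  "rerouted_tensor \<phi> v s r =
     (if v = z \<and> \<not> consistent r then 0
      else \<phi> v s (restrict (old_index v r) (incident_edges E v)))"

text \<open>When the two copies agree, it no longer matters which vertex reads them, so
  \<open>x\<close> can stand for all vertices. The inner restriction to \<open>E\<close> exhibits
  one global old assignment shared by all factors.\<close>

lemma rerouted_tensor_consistent:
  assumes "consistent r"
  shows "rerouted_tensor \<phi> v s (restrict r (incident_edges E' v))
    = \<phi> v s (restrict (restrict (old_index x r) E) (incident_edges E v))"
proof -
  let ?r = "restrict r (incident_edges E' v)"
  have "consistent ?r" if "v = z"
    using that assms by (simp add: consistent_def incident_edges_def edge_in_rerouted)
  \<comment> \<open>If \<open>f = {x, y}\<close>, then \<open>v\<close> is \<open>x\<close> or
    \<open>y\<close> and reads its copy from \<open>{v, z}\<close>, which is incident to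
    \<open>v\<close>; any other \<open>f\<close> survives in \<open>E'\<close> and is read
    directly.\<close>
  moreover have "old_index v ?r f = old_index x r f" if "f \<in> incident_edges E v" for f
    using that assms edges_ne
    by (auto simp: old_index_def incident_edges_def edge_in_rerouted consistent_def)
  then have "restrict (old_index v ?r) (incident_edges E v)
    = restrict (restrict (old_index x r) E) (incident_edges E v)"
    by (auto simp: fun_eq_iff incident_edges_def)
  ultimately show ?thesis
    by (auto simp: rerouted_tensor_def)
qed

lemma prod_rerouted_tensor:
  "(\<Prod>v\<in>{1..n}. rerouted_tensor \<phi> v (i v) (restrict r (incident_edges E' v)))
    = (if consistent r
       then \<Prod>v\<in>{1..n}. \<phi> v (i v) (restrict (restrict (old_index x r) E) (incident_edges E v))
       else 0)"
proof (cases "consistent r")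
  case False
  \<comment> \<open>Both edges that carry a copy are incident to \<open>z\<close>, so the
    restriction does not hide the disagreement.\<close>
  have "\<not> consistent (restrict r (incident_edges E' z))"
    using False by (simp add: consistent_def incident_edges_def edge_in_rerouted)
  then have "rerouted_tensor \<phi> z (i z) (restrict r (incident_edges E' z)) = 0"
    by (simp add: rerouted_tensor_def)
  then show ?thesis
    using False z by (auto intro!: prod_zero)
qed (simp add: rerouted_tensor_consistent)

section \<open>Bijection between old and consistent new index assignments\<close>

lemma rerouted_weight_simps:
  "w' {x, z} = wxz * w {x, y}" "w' {y, z} = wyz * w {x, y}"
  "f \<in> E \<Longrightarrow> f \<noteq> {x, z} \<Longrightarrow> f \<noteq> {y, z} \<Longrightarrow> w' f = w f"
  using xy by (auto simp: rerouted_weight_def extended_weight_def)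

lemma old_index_in:
  assumes "r \<in> virt_indices E' w'"
  shows "restrict (old_index x r) E \<in> virt_indices E w"
proof -
  have r: "r f \<in> {1..w' f}" if "f \<in> E'" for f
    using assms that by (auto simp: virt_indices_def PiE_iff)
  have "old_index x r f \<in> {1..w f}" if f: "f \<in> E" for f
  proof -
    consider "f = {x, y}" | "f = {x, z}" | "f = {y, z}" | "f \<noteq> {x, y}" "f \<noteq> {x, z}" "f \<noteq> {y, z}"
      by blast
    then show ?thesis
    proof cases
      case 1
      then show ?thesis
        using r[of "{x, z}"] pack_snd_in[of "r {x, z}" wxz "w {x, y}"]
        by (simp add: old_index_def edge_in_rerouted rerouted_weight_simps)
    next
      case 2
      then show ?thesis
        using pack_fst_in[OF extended_weight_ge_1, of f "r f"] f edges_ne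
        by (simp add: old_index_def extended_weight_def)
    next
      case 3
      then show ?thesis
        using pack_fst_in[OF extended_weight_ge_1, of f "r f"] f edges_ne
        by (simp add: old_index_def extended_weight_def)
    next
      case 4
      then show ?thesis
        using r[of f] f by (simp add: old_index_def edge_in_rerouted rerouted_weight_simps)
    qed
  qed
  then show ?thesis
    by (simp add: virt_indices_def)
qed

context
  fixes j
  assumes j: "j \<in> virt_indices E w"
begin

lemma index_in: "f \<in> E \<Longrightarrow> j f \<in> {1..w f}"
  using j by (auto simp: virt_indices_def PiE_iff)

lemma extended_index_in: "(if f \<in> E then j f else 1) \<in> {1..extended_weight E w f}"
  using index_in by (auto simp: extended_weight_def)

lemma new_index_in: "restrict (new_index j) E' \<in> virt_indices E' w'"
proof -
  have "new_index j f \<in> {1..w' f}" if "f \<in> E'" for f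
  proof (cases "f \<in> {{x, z}, {y, z}}")
    case True
    then show ?thesis
      using pack_in[OF extended_index_in index_in[OF xy], of f] xy
      by (auto simp: new_index_def rerouted_weight_def extended_weight_def)
  next
    case False
    then show ?thesis
      using that index_in[of f] by (auto simp: new_index_def edge_in_rerouted rerouted_weight_simps)
  qed
  then show ?thesis
    by (simp add: virt_indices_def)
qed

lemma pack_new_index:
  assumes "f \<in> {{x, z}, {y, z}}"
  shows "pack_fst (extended_weight E w f) (new_index j f) = (if f \<in> E then j f else 1)"
    and "pack_snd (extended_weight E w f) (new_index j f) = j {x, y}"
  using assms pack_fst_pack[OF extended_index_in, of f] index_in[OF xy]
    pack_snd_pack[OF extended_index_in, of "j {x, y}" f]
  unfolding new_index_def by simp_all

lemma consistent_new_index: "consistent (restrict (new_index j) E')"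
  using pack_new_index(2)[of "{x, z}"] pack_new_index(2)[of "{y, z}"]
  by (simp add: consistent_def edge_in_rerouted)

lemma old_index_new_index: "restrict (old_index x (restrict (new_index j) E')) E = j"
proof
  fix f
  show "restrict (old_index x (restrict (new_index j) E')) E f = j f"
  proof (cases "f \<in> E")
    case True
    then show ?thesis
      using pack_new_index[of "{x, z}"] pack_new_index[of "{y, z}"] edges_ne
      by (auto simp: old_index_def edge_in_rerouted new_index_def[of j f])
  next
    case False
    then show ?thesis
      using j by (auto simp: virt_indices_def)
  qed
qed

end

text \<open>Consistency is essential: \<open>old_index x\<close> takes the index of
  \<open>{x, y}\<close> from \<open>{x, z}\<close> alone, and \<open>new_index\<close> writes it to
  both edges, so the value at \<open>{y, z}\<close> is recovered only if its copy agrees.\<close>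

lemma new_index_old_index:
  assumes r: "r \<in> virt_indices E' w'" and c: "consistent r"
  shows "restrict (new_index (restrict (old_index x r) E)) E' = r"
proof
  fix f
  have ge_1: "1 \<le> r g" if "g \<in> E'" for g
    using r that by (auto simp: virt_indices_def PiE_iff)
  \<comment> \<open>An absent edge has extended weight 1, and remainders modulo 1 vanish; this
    matches the default index 1 in \<open>new_index\<close>.\<close>
  have fst_1: "pack_fst (extended_weight E w g) k = 1" if "g \<notin> E" for g k
    using that by (simp add: pack_fst_def extended_weight_def)
  show "restrict (new_index (restrict (old_index x r) E)) E' f = r f"
  proof (cases "f \<in> E'")
    case True
    show ?thesis
    proof (cases "f \<in> {{x, z}, {y, z}}")
      case f: True
      let ?j = "restrict (old_index x r) E"
      have p: "(if f \<in> E then ?j f else 1) = pack_fst (extended_weight E w f) (r f)"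
        using f edges_ne fst_1 by (auto simp: old_index_def)
      have q: "?j {x, y} = pack_snd (extended_weight E w f) (r f)"
        using f xy c by (auto simp: old_index_def consistent_def)
      have "new_index ?j f = r f"
        unfolding new_index_def p q using f pack_collapse[OF ge_1[OF True]] by simp
      then show ?thesis
        using True by simp
    next
      case False
      then show ?thesis
        using True by (auto simp: new_index_def old_index_def edge_in_rerouted)
    qed
  next
    case False
    then show ?thesis
      using r by (auto simp: virt_indices_def)
  qed
qed

section \<open>Equality of the contractions\<close>

lemma contraction_rerouted_tensor:
  "contraction n E' w' (rerouted_tensor \<phi>) i = contraction n E w \<phi> i"
proof -
  have "finite (virt_indices E' w')"
    using weighted_graph_rerouted
    by (auto simp: virt_indices_def weighted_graph_def intro!: finite_PiE dest: simple_graph_finite)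
  then have "contraction n E' w' (rerouted_tensor \<phi>) i
    = (\<Sum>r\<in>{r \<in> virt_indices E' w'. consistent r}.
        \<Prod>v\<in>{1..n}. \<phi> v (i v) (restrict (restrict (old_index x r) E) (incident_edges E v)))"
    unfolding contraction_def prod_rerouted_tensor by (rule sum.inter_filter[symmetric])
  also have "\<dots> = contraction n E w \<phi> i"
    unfolding contraction_def
    \<comment> \<open>The two maps are mutually inverse only because the sum is already confined to
      consistent assignments; otherwise several new assignments could decode to the same old
      one.\<close>
    by (rule sum.reindex_bij_witness[where i = "\<lambda>j. restrict (new_index j) E'"
          and j = "\<lambda>r. restrict (old_index x r) E"])
      (auto simp only: mem_Collect_eq new_index_old_index old_index_in old_index_new_index
        new_index_in consistent_new_index)
  finally show ?thesis .
qed

text \<open>The amplitudes are reproduced exactly, so the state and its normalisation stay the same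
  and \<open>rerouted_tensor \<phi>\<close> is the required witness.\<close>

lemma tn_states_rerouted: "tn_states d n E w \<subseteq> tn_states d n E' w'"
proof
  fix \<psi> assume "\<psi> \<in> tn_states d n E w"
  then obtain \<phi> where "\<psi> \<in> pure_states d n"
    and "\<forall>i\<in>phys_indices d n. \<psi> i = contraction n E' w' (rerouted_tensor \<phi>) i"
    by (auto simp: tn_states_def contraction_rerouted_tensor)
  then show "\<psi> \<in> tn_states d n E' w'"
    unfolding tn_states_def by blast
qed

end

theorem theorem1p1:
  fixes n d x y z :: nat and E :: "nat set set" and w :: "nat set \<Rightarrow> nat"
  assumes "weighted_graph n E w"
    and "1 \<le> d"
    and "{x, y} \<in> E"
    and "z \<in> {1..n} - {x, y}"
  shows "weighted_graph n (rerouted_edges E x y z) (rerouted_weight E w x y z)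
    \<and> (\<forall>\<psi>. \<psi> \<in> tn_states d n E w
          \<longrightarrow> \<psi> \<in> tn_states d n (rerouted_edges E x y z) (rerouted_weight E w x y z))
    \<and> tn_states d n E w \<subseteq> tn_states d n (rerouted_edges E x y z) (rerouted_weight E w x y z)
    \<and> (\<forall>\<chi>::nat. (\<forall>f\<in>E. w f \<le> \<chi>)
          \<longrightarrow> (\<forall>f\<in>rerouted_edges E x y z. rerouted_weight E w x y z f \<le> \<chi>\<^sup>2))"
proof -
  interpret rerouting n E w x y z
    using assms by unfold_locales
  show ?thesis
    using weighted_graph_rerouted tn_states_rerouted rerouted_weight_le_square by blast
qed

end
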